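(* Let $f:\mathbb{R}^n\to\mathbb{R}$, $h:\mathbb{R}^n\to\mathbb{R}^p$, $g:\mathbb{R}^n\to\mathbb{R}^m$ be continuously differentiable. Consider the controller $$\mu=\mathrm{ReLU}\big(\xi+k_p^{in}g(x)\big),\qquad\dot\xi=k_i^{in}(\mu-\xi),$$ with $k_i^{in},k_p^{in}\in\mathbb{R}_{>0}$, and let $x(t)$ be a trajectory of $$\dot x(t)=-\nabla f(x(t))-J_h(x(t))^\top\lambda(t)-J_g(x(t))^\top\mu(t).$$ If $\xi(0)\in\mathbb{R}^m_{\ge0}$, then $\xi(t)\in\mathbb{R}^m_{\ge0}$ for all $t\ge0$.
   Context: $\mathrm{ReLU}(y)=\max(y,0)$ componentwise. $J_h,J_g$ are Jacobians. $\lambda(t)\in\mathbb{R}^p$ and $\mu(t)\in\mathbb{R}^m$ are the inputs (Lagrange multipliers) of the $x$-system; $\xi\in\mathbb{R}^m$ is the internal state of the controller. *)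

theory Defs
  imports "HOL-Analysis.Analysis"
begin

definition continuously_differentiable ::
    "('a::real_normed_vector \<Rightarrow> 'b::real_normed_vector) \<Rightarrow> bool" where
  "continuously_differentiable f \<longleftrightarrow>
     (\<exists>f' :: 'a \<Rightarrow> 'a \<Rightarrow>\<^sub>L 'b.
        (\<forall>x. (f has_derivative blinfun_apply (f' x)) (at x)) \<and> continuous_on UNIV f')"

text \<open>The gradient is the vector representing the derivative via the inner product; it is
  unspecified at points where \<open>f\<close> is not differentiable.\<close>

definition gradient :: "('a::real_inner \<Rightarrow> real) \<Rightarrow> 'a \<Rightarrow> 'a" where
  "gradient f x = (THE D. GDERIV f x :> D)"

definition relu :: "real ^ 'm \<Rightarrow> real ^ 'm" where
  "relu y = (\<chi> i. max (y $ i) 0)"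

text \<open>Trajectories are classical solutions on \<open>[0, \<infinity>)\<close>; the derivative at the initial time is
  one-sided. Signals are functions on all of \<open>real\<close>, but only their values at nonnegative times
  are constrained. The inputs \<open>l\<close> and \<open>mu\<close> are arbitrary signals, with no assumed regularity.\<close>

definition primal_trajectory ::
    "(real ^ 'n \<Rightarrow> real) \<Rightarrow> (real ^ 'n \<Rightarrow> real ^ 'p) \<Rightarrow> (real ^ 'n \<Rightarrow> real ^ 'm) \<Rightarrow>
     (real \<Rightarrow> real ^ 'p) \<Rightarrow> (real \<Rightarrow> real ^ 'm) \<Rightarrow> (real \<Rightarrow> real ^ 'n) \<Rightarrow> bool" where
  "primal_trajectory f h g l mu x \<longleftrightarrow>
     (\<forall>t\<ge>0. (x has_vector_derivative
        (- gradient f (x t)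
         - transpose (jacobian h (at (x t))) *v l t
         - transpose (jacobian g (at (x t))) *v mu t)) (at t within {0..}))"

definition controller_trajectory ::
    "real \<Rightarrow> real \<Rightarrow> (real ^ 'n \<Rightarrow> real ^ 'm) \<Rightarrow>
     (real \<Rightarrow> real ^ 'n) \<Rightarrow> (real \<Rightarrow> real ^ 'm) \<Rightarrow> (real \<Rightarrow> real ^ 'm) \<Rightarrow> bool" where
  "controller_trajectory ki kp g x xi mu \<longleftrightarrow>
     (\<forall>t\<ge>0. mu t = relu (xi t + kp *\<^sub>R g (x t)) \<and>
        (xi has_vector_derivative (ki *\<^sub>R (mu t - xi t))) (at t within {0..}))"

end

theory Submission
  imports Defs
begin

text \<open>Each component of \<open>\<xi>\<close> satisfies \<open>\<xi>' \<ge> - k\<^sub>i \<xi>\<close> because a ReLU output is nonnegative. With the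
  integrating factor, \<open>exp (k\<^sub>i t) * \<xi>\<close> is nondecreasing, so the sign of the initial value persists.\<close>

lemma nonneg_if_deriv_ge_linear:
  fixes u u' :: "real \<Rightarrow> real"
  assumes deriv: "\<And>s. a \<le> s \<Longrightarrow> (u has_real_derivative u' s) (at s within {a..})"
    and ge: "\<And>s. a \<le> s \<Longrightarrow> u' s \<ge> - c * u s"
    and init: "u a \<ge> 0" and "a \<le> t"
  shows "u t \<ge> 0"
proof -
  define v where "v s = exp (c * s) * u s" for s
  \<comment> \<open>The second factor is nonnegative by \<open>ge\<close>. The derivative is kept
    one-sided at \<open>a\<close>, since \<open>deriv\<close> says nothing about times before
    \<open>a\<close>.\<close>
  have dv: "(v has_real_derivative exp (c * s) * (u' s + c * u s)) (at s within {a..})"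
    if "a \<le> s" for s
    unfolding v_def by (auto intro!: derivative_eq_intros deriv that simp: algebra_simps)
  have "v a \<le> v t"
  \<comment> \<open>This form of monotonicity asks for a two-sided derivative only strictly between
    \<open>a\<close> and \<open>t\<close>; at \<open>a\<close> itself continuity is enough.\<close>
  proof (rule DERIV_nonneg_imp_increasing_open[OF \<open>a \<le> t\<close>])
    fix s assume s: "a < s" "s < t"
    then have "at s within {a..} = at s"
      by (intro at_within_interior) simp
    with s dv[of s] ge[of s]
    show "\<exists>y. (v has_real_derivative y) (at s) \<and> 0 \<le> y"
      by (intro exI[of _ "exp (c * s) * (u' s + c * u s)"]) auto
  next
    have "continuous_on {a..} v"
      by (rule DERIV_continuous_on) (auto intro: dv)
    then show "continuous_on {a..t} v"
      by (rule continuous_on_subset) auto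
  qed
  moreover have "v a \<ge> 0"
    using init by (simp add: v_def)
  ultimately have "0 \<le> v t"
    by simp
  then show ?thesis
    by (simp add: v_def zero_le_mult_iff)
qed

theorem lemma3p1:
  fixes f :: "real ^ 'n \<Rightarrow> real"
    and h :: "real ^ 'n \<Rightarrow> real ^ 'p"
    and g :: "real ^ 'n \<Rightarrow> real ^ 'm"
    and ki kp :: real
    and x :: "real \<Rightarrow> real ^ 'n"
    and l :: "real \<Rightarrow> real ^ 'p"
    and mu xi :: "real \<Rightarrow> real ^ 'm"
  assumes "continuously_differentiable f"
    and "continuously_differentiable h"
    and "continuously_differentiable g"
    and "ki > 0" and "kp > 0"
    and "controller_trajectory ki kp g x xi mu"
    and "primal_trajectory f h g l mu x"
    and "\<forall>i. xi 0 $ i \<ge> 0"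
  shows "\<forall>t\<ge>0. \<forall>i. xi t $ i \<ge> 0"
proof (intro allI impI)
  fix t :: real and i
  assume "0 \<le> t"
  show "xi t $ i \<ge> 0"
  \<comment> \<open>The decay rate is \<open>ki\<close>: dropping the nonnegative term
    \<open>ki * mu s $ i\<close> from the controller equation leaves exactly the bound
    \<open>- ki * xi s $ i\<close>.\<close>
  proof (rule nonneg_if_deriv_ge_linear[of 0 "\<lambda>s. xi s $ i" "\<lambda>s. ki * (mu s $ i - xi s $ i)" ki])
    fix s :: real assume s: "0 \<le> s"
    have "(xi has_vector_derivative ki *\<^sub>R (mu s - xi s)) (at s within {0..})"
      using assms(6) s unfolding controller_trajectory_def by blast
    \<comment> \<open>Projection to a coordinate is bounded linear, so it commutes with the
      one-sided derivative.\<close>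
    from bounded_linear.has_vector_derivative[OF bounded_linear_vec_nth this, of i]
    show "((\<lambda>s. xi s $ i) has_real_derivative ki * (mu s $ i - xi s $ i)) (at s within {0..})"
      by (simp add: has_real_derivative_iff_has_vector_derivative)
    have "mu s $ i \<ge> 0"
      using assms(6) s by (simp add: controller_trajectory_def relu_def)
    then show "ki * (mu s $ i - xi s $ i) \<ge> - ki * xi s $ i"
      using \<open>ki > 0\<close> by (simp add: algebra_simps)
  qed (use assms(8) \<open>0 \<le> t\<close> in auto)
qed

end
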